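(* Let $G$ be a finite graph whose vertex set is partitioned into $V_1 \sqcup V_2 \sqcup \dots \sqcup V_m$. Let $q$ be a prime power with $q > 2N(v) + N^2(v)$ for every vertex $v$ of $G$. If $|V_j| \ge 2q-1$ for all $j$, then there are $q$ pairwise disjoint independent sets $S_1, \dots, S_q$ of $G$ such that each $S_i$ intersects each $V_j$.
   Context: For a vertex $v$, $N(v)$ denotes the number of neighbors of $v$, and $N^2(v)$ the number of vertices at distance exactly two from $v$. A set of vertices is independent if it contains no two endpoints of an edge. *)

theory Defs
  imports
    "Graph_Theory.Graph_Theory"
    "HOL-Library.Disjoint_Sets"
    "HOL-Number_Theory.Prime_Powers"
begin

definition graph_dist :: "('a, 'b) pre_digraph \<Rightarrow> 'a \<Rightarrow> 'a \<Rightarrow> ereal" where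
  "graph_dist G u v = wf_digraph.\<mu> G (\<lambda>_. 1) u v"

definition num_neighbors :: "('a, 'b) pre_digraph \<Rightarrow> 'a \<Rightarrow> nat" where
  "num_neighbors G v = card {u \<in> verts G. v \<rightarrow>\<^bsub>G\<^esub> u}"

definition num_at_distance_two :: "('a, 'b) pre_digraph \<Rightarrow> 'a \<Rightarrow> nat" where
  "num_at_distance_two G v = card {u \<in> verts G. graph_dist G v u = 2}"

definition independent_set :: "('a, 'b) pre_digraph \<Rightarrow> 'a set \<Rightarrow> bool" where
  "independent_set G S \<longleftrightarrow> S \<subseteq> verts G \<and> (\<forall>u\<in>S. \<forall>v\<in>S. \<not> u \<rightarrow>\<^bsub>G\<^esub> v)"

end

theory Submission
  imports Defs
begin

text \<open>
  Since \<open>q > 2 N(v)\<close>, Haxell's theorem applies: disjoint classes of size at least twice the maximum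
  degree have an independent transversal. After fewer than \<open>q\<close> disjoint transversals have been
  removed, every class still has at least \<open>q\<close> vertices, so \<open>q\<close> of them can be chosen greedily.

  Haxell's theorem follows from its domination form: if no independent transversal exists, then
  some nonempty subfamily \<open>J\<close> of the classes is totally dominated by \<open>2(|J| - 1)\<close> vertices. To prove
  this, suppose that an independent transversal \<open>t\<close> of the classes \<open>I\<close> does not extend to a further
  class \<open>a\<close>. Fix \<open>x\<close> in class \<open>a\<close>, choose \<open>t\<close> with as few neighbours of \<open>x\<close> as possible, and let \<open>H\<close>
  be the classes of these neighbours; \<open>H\<close> is nonempty, as otherwise \<open>x\<close> would extend \<open>t\<close>. Delete
  everything adjacent to \<open>x\<close> or to \<open>t(H)\<close>, and merge the classes \<open>H\<close> into \<open>a\<close>. Then \<open>t\<close> is still an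
  independent transversal of the classes \<open>I - H\<close>, and no independent transversal \<open>s\<close> covers the
  merged class as well. Indeed, if \<open>s\<close> chooses there a vertex from class \<open>k\<close>, then \<open>s\<close> and
  \<open>t(H - {k})\<close> together form an independent transversal of \<open>I\<close> and \<open>k\<close>: for \<open>k = a\<close> this is excluded
  by assumption, and for \<open>k\<close> in \<open>H\<close> it has fewer neighbours of \<open>x\<close> than \<open>t\<close>. Induction gives a
  dominating set for the merged family, to which \<open>x\<close> and \<open>t(H)\<close> are added: at most \<open>2|H|\<close> vertices
  for \<open>|H|\<close> more classes.
\<close>

locale loopfree_sym_digraph = loopfree_digraph + sym_digraph

sublocale graph \<subseteq> loopfree_sym_digraph
  by unfold_locales

definition neighbourhood :: "('a, 'b) pre_digraph \<Rightarrow> 'a set \<Rightarrow> 'a set" where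
  "neighbourhood G D = {v \<in> verts G. \<exists>u\<in>D. u \<rightarrow>\<^bsub>G\<^esub> v}"

definition independent_choice ::
  "('a, 'b) pre_digraph \<Rightarrow> ('i \<Rightarrow> 'a set) \<Rightarrow> 'i set \<Rightarrow> ('i \<Rightarrow> 'a) \<Rightarrow> bool" where
  "independent_choice G V I t \<longleftrightarrow> (\<forall>i\<in>I. t i \<in> V i) \<and> independent_set G (t ` I)"

definition independent_transversal ::
  "('a, 'b) pre_digraph \<Rightarrow> ('i \<Rightarrow> 'a set) \<Rightarrow> 'i set \<Rightarrow> 'a set \<Rightarrow> bool" where
  "independent_transversal G V I T \<longleftrightarrow> independent_set G T \<and> (\<forall>i\<in>I. is_singleton (T \<inter> V i))"

definition totally_dominating_set ::
  "('a, 'b) pre_digraph \<Rightarrow> ('i \<Rightarrow> 'a set) \<Rightarrow> 'i set \<Rightarrow> 'a set \<Rightarrow> bool" where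
  "totally_dominating_set G V J D \<longleftrightarrow>
     finite D \<and> D \<subseteq> (\<Union>j\<in>J. V j) \<and> (\<Union>j\<in>J. V j) \<subseteq> neighbourhood G D"

definition conflicts :: "('a, 'b) pre_digraph \<Rightarrow> 'i set \<Rightarrow> ('i \<Rightarrow> 'a) \<Rightarrow> 'a \<Rightarrow> 'i set" where
  "conflicts G I t x = {i \<in> I. x \<rightarrow>\<^bsub>G\<^esub> t i}"

definition conflict_star :: "('a, 'b) pre_digraph \<Rightarrow> 'i set \<Rightarrow> ('i \<Rightarrow> 'a) \<Rightarrow> 'a \<Rightarrow> 'a set" where
  "conflict_star G I t x = insert x (t ` conflicts G I t x)"

text \<open>The merged class keeps the index \<open>a\<close>; the classes of the conflicts stay in the family and are
  discarded by restricting the index set.\<close>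

definition contracted_classes ::
  "('a, 'b) pre_digraph \<Rightarrow> ('i \<Rightarrow> 'a set) \<Rightarrow> 'i set \<Rightarrow> 'i \<Rightarrow> ('i \<Rightarrow> 'a) \<Rightarrow> 'a \<Rightarrow> 'i \<Rightarrow> 'a set" where
  "contracted_classes G V I a t x i =
     (if i = a then \<Union>j\<in>insert a (conflicts G I t x). V j else V i)
       - neighbourhood G (conflict_star G I t x)"

lemma neighbourhood_Un: "neighbourhood G (C \<union> D) = neighbourhood G C \<union> neighbourhood G D"
  by (auto simp: neighbourhood_def)

lemma card_neighbourhood_le:
  assumes "finite D" and "\<And>u. u \<in> D \<Longrightarrow> num_neighbors G u \<le> d"
  shows "card (neighbourhood G D) \<le> card D * d"
proof -
  have "neighbourhood G D = (\<Union>u\<in>D. {v \<in> verts G. u \<rightarrow>\<^bsub>G\<^esub> v})"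
    by (auto simp: neighbourhood_def)
  then have "card (neighbourhood G D) \<le> (\<Sum>u\<in>D. num_neighbors G u)"
    using card_UN_le[OF \<open>finite D\<close>] by (simp add: num_neighbors_def)
  also have "\<dots> \<le> card D * d"
    using sum_bounded_above[of D "num_neighbors G" d] assms(2) by simp
  finally show ?thesis .
qed

lemma independent_set_mono: "independent_set G T \<Longrightarrow> S \<subseteq> T \<Longrightarrow> independent_set G S"
  by (auto simp: independent_set_def)

lemma independent_choice_mono:
  assumes "independent_choice G V I t" and "J \<subseteq> I" and "\<And>i. i \<in> J \<Longrightarrow> V i \<subseteq> W i"
  shows "independent_choice G W J t"
  using assms independent_set_mono[OF _ image_mono[OF \<open>J \<subseteq> I\<close>]]
  unfolding independent_choice_def by blast

lemma independent_transversal_image: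
  assumes "independent_choice G V I t" and "disjoint_family_on V I"
  shows "independent_transversal G V I (t ` I)"
proof -
  have "t j \<in> V i \<longleftrightarrow> j = i" if "i \<in> I" "j \<in> I" for i j
    using assms that unfolding independent_choice_def disjoint_family_on_def by blast
  then have "t ` I \<inter> V i = {t i}" if "i \<in> I" for i
    using that by auto
  then show ?thesis
    using assms(1) by (simp add: independent_transversal_def independent_choice_def)
qed

lemma card_Diff_independent_transversals:
  assumes "finite K" and "\<And>k. k \<in> K \<Longrightarrow> independent_transversal G V I (S k)" and "i \<in> I"
  shows "card (V i) \<le> card (V i - (\<Union>k\<in>K. S k)) + card K"
proof -
  let ?T = "\<Union>k\<in>K. S k \<inter> V i"
  have card_meet: "card (S k \<inter> V i) = 1" if "k \<in> K" for k
    using assms that by (simp add: independent_transversal_def is_singleton_altdef)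
  then have "finite ?T"
    using \<open>finite K\<close> by (intro finite_UN_I) (simp_all add: card_ge_0_finite)
  moreover have "V i - (\<Union>k\<in>K. S k) = V i - ?T" by blast
  ultimately have "card (V i) - card ?T \<le> card (V i - (\<Union>k\<in>K. S k))"
    by (simp only: diff_card_le_card_Diff)
  moreover have "card ?T \<le> (\<Sum>k\<in>K. card (S k \<inter> V i))"
    using \<open>finite K\<close> by (rule card_UN_le)
  then have "card ?T \<le> card K" using card_meet by simp
  ultimately show ?thesis by linarith
qed

lemma conflicts_subset: "conflicts G I t x \<subseteq> I"
  by (auto simp: conflicts_def)

lemma finite_conflicts: "finite I \<Longrightarrow> finite (conflicts G I t x)"
  by (simp add: conflicts_def)

lemma contracted_classes_subset:
  "i \<in> insert a I \<Longrightarrow> contracted_classes G V I a t x i \<subseteq> (\<Union>j\<in>insert a I. V j)"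
  by (auto simp: contracted_classes_def conflicts_def)

lemma card_conflict_star_le:
  assumes "finite I" and "conflicts G I t x \<noteq> {}"
  shows "card (conflict_star G I t x) \<le> 2 * card (conflicts G I t x)"
proof -
  have "finite (conflicts G I t x)"
    using \<open>finite I\<close> by (rule finite_conflicts)
  then have "card (t ` conflicts G I t x) \<le> card (conflicts G I t x)" "0 < card (conflicts G I t x)"
    using assms(2) by (simp_all add: card_image_le card_gt_0_iff)
  then show ?thesis
    using card_insert_le_m1[of "2 * card (conflicts G I t x)" "t ` conflicts G I t x" x]
    by (simp add: conflict_star_def)
qed

lemma totally_dominating_set_uncontract:
  assumes "finite I" and "independent_choice G V I t" and "x \<in> V a" and "a \<notin> J"
    and "totally_dominating_set G (contracted_classes G V I a t x) (insert a J) D"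
  shows "totally_dominating_set G V (insert a (J \<union> conflicts G I t x)) (conflict_star G I t x \<union> D)"
  unfolding totally_dominating_set_def
proof (intro conjI)
  let ?V' = "contracted_classes G V I a t x"
  have D: "finite D" "D \<subseteq> (\<Union>j\<in>insert a J. ?V' j)" "(\<Union>j\<in>insert a J. ?V' j) \<subseteq> neighbourhood G D"
    using assms(5) by (simp_all add: totally_dominating_set_def)
  show "finite (conflict_star G I t x \<union> D)"
    using D(1) \<open>finite I\<close> by (simp add: conflict_star_def finite_conflicts)
  have "conflict_star G I t x \<subseteq> (\<Union>j\<in>insert a (J \<union> conflicts G I t x). V j)"
    using assms(2,3) by (auto simp: conflict_star_def conflicts_def independent_choice_def)
  moreover have "D \<subseteq> (\<Union>j\<in>insert a (J \<union> conflicts G I t x). V j)"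
    using D(2) \<open>a \<notin> J\<close> by (fastforce simp: contracted_classes_def split: if_splits)
  ultimately show "conflict_star G I t x \<union> D \<subseteq> (\<Union>j\<in>insert a (J \<union> conflicts G I t x). V j)"
    by blast
  have "(\<Union>j\<in>insert a (J \<union> conflicts G I t x). V j)
      \<subseteq> neighbourhood G (conflict_star G I t x) \<union> (\<Union>j\<in>insert a J. ?V' j)"
    using \<open>a \<notin> J\<close> by (auto simp: contracted_classes_def)
  also have "\<dots> \<subseteq> neighbourhood G (conflict_star G I t x \<union> D)"
    unfolding neighbourhood_Un using D(3) by (intro Un_mono order_refl)
  finally show "(\<Union>j\<in>insert a (J \<union> conflicts G I t x). V j)
      \<subseteq> neighbourhood G (conflict_star G I t x \<union> D)" .
qed

lemma small_totally_dominating_set_uncontract: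
  assumes "finite I" and "a \<notin> I" and t: "independent_choice G V I t" and "x \<in> V a"
    and "conflicts G I t x \<noteq> {}" and J: "J \<subseteq> I - conflicts G I t x"
    and D: "totally_dominating_set G (contracted_classes G V I a t x) (insert a J) D"
    and card_D: "card D \<le> 2 * card J"
  shows "\<exists>J'\<subseteq>I. \<exists>D'. totally_dominating_set G V (insert a J') D' \<and> card D' \<le> 2 * card J'"
proof -
  let ?J' = "J \<union> conflicts G I t x" and ?D' = "conflict_star G I t x \<union> D"
  have "?J' \<subseteq> I" using J conflicts_subset[of G I t x] by blast
  moreover have "totally_dominating_set G V (insert a ?J') ?D'"
    using \<open>a \<notin> I\<close> J D
    by (intro totally_dominating_set_uncontract[OF \<open>finite I\<close> t \<open>x \<in> V a\<close>]) auto
  moreover have "card ?J' = card J + card (conflicts G I t x)"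
    using J \<open>finite I\<close> by (intro card_Un_disjoint) (auto intro: finite_subset finite_conflicts)
  then have "card ?D' \<le> 2 * card ?J'"
    using card_Un_le[of "conflict_star G I t x" D] card_D
      card_conflict_star_le[OF \<open>finite I\<close> \<open>conflicts G I t x \<noteq> {}\<close>] by linarith
  ultimately show ?thesis by blast
qed

context loopfree_sym_digraph
begin

lemma independent_choice_singleton:
  "x \<in> V a \<Longrightarrow> x \<in> verts G \<Longrightarrow> independent_choice G V {a} (\<lambda>_. x)"
  using adj_not_same by (auto simp: independent_choice_def independent_set_def)

lemma independent_choice_override_on:
  assumes s: "independent_choice G V A s" and t: "independent_choice G V B t"
    and nonadj: "\<And>i j. i \<in> A \<Longrightarrow> j \<in> B \<Longrightarrow> \<not> t j \<rightarrow>\<^bsub>G\<^esub> s i"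
  shows "independent_choice G V (A \<union> B) (override_on s t B)"
proof -
  have "\<not> s i \<rightarrow>\<^bsub>G\<^esub> t j" if "i \<in> A" "j \<in> B" for i j
    using nonadj[OF that] graph_symmetric by blast
  then have "independent_set G (s ` A \<union> t ` B)"
    using s t nonadj by (auto simp: independent_choice_def independent_set_def)
  moreover have "override_on s t B ` (A \<union> B) \<subseteq> s ` A \<union> t ` B"
    by (auto simp: override_on_def)
  ultimately have "independent_set G (override_on s t B ` (A \<union> B))"
    by (rule independent_set_mono)
  then show ?thesis
    using s t by (auto simp: independent_choice_def override_on_def)
qed

lemma independent_choice_insert:
  assumes "independent_choice G V I t" and "conflicts G I t x = {}" and "x \<in> V a" and "x \<in> verts G"
  shows "independent_choice G V (insert a I) (t(a := x))"
proof -
  have "independent_choice G V (I \<union> {a}) (override_on t (\<lambda>_. x) {a})"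
    using assms by (intro independent_choice_override_on independent_choice_singleton)
      (auto simp: conflicts_def)
  then show ?thesis
    by (simp add: override_on_insert)
qed

lemma independent_choice_contract:
  assumes "independent_choice G V I t" and "a \<notin> I"
  shows "independent_choice G (contracted_classes G V I a t x) (I - conflicts G I t x) t"
proof -
  have "t i \<notin> neighbourhood G (conflict_star G I t x)" if "i \<in> I - conflicts G I t x" for i
    using assms that
    by (auto simp: neighbourhood_def conflict_star_def conflicts_def independent_choice_def
        independent_set_def)
  then show ?thesis
    using assms by (auto simp: contracted_classes_def independent_choice_def independent_set_def)
qed

lemma independent_choice_uncontract:
  fixes x :: 'a
  assumes t: "independent_choice G V I t" and "a \<notin> I"
  defines "H \<equiv> conflicts G I t x"
  assumes s: "independent_choice G (contracted_classes G V I a t x) (insert a (I - H)) s"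
  shows "\<exists>k\<in>insert a H. \<exists>t'. independent_choice G V (insert k I) t' \<and> conflicts G I t' x \<subseteq> H - {k}"
proof -
  have "H \<subseteq> I" by (simp add: H_def conflicts_subset)
  have "s a \<in> (\<Union>k\<in>insert a H. V k)"
    using s by (simp add: independent_choice_def contracted_classes_def H_def)
  then obtain k where k: "k \<in> insert a H" "s a \<in> V k" by blast
  define s' where "s' = s(k := s a)"
  define t' where "t' = override_on s' t (H - {k})"
  have s'_nonadj: "\<not> u \<rightarrow>\<^bsub>G\<^esub> s' i" if "u \<in> insert x (t ` H)" "i \<in> insert k (I - H)" for u i
    using s that by (auto simp: s'_def H_def contracted_classes_def neighbourhood_def
        conflict_star_def independent_choice_def independent_set_def)
  have "s i \<in> V i" if "i \<in> I - H" for i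
    using s that \<open>a \<notin> I\<close>
    by (fastforce simp: independent_choice_def contracted_classes_def split: if_splits)
  moreover have "s' ` insert k (I - H) = s ` insert a (I - H)"
    using k(1) \<open>H \<subseteq> I\<close> \<open>a \<notin> I\<close> by (auto simp: s'_def)
  ultimately have "independent_choice G V (insert k (I - H)) s'"
    using s k(2) by (simp add: independent_choice_def) (simp add: s'_def)
  moreover have "independent_choice G V (H - {k}) t"
    using \<open>H \<subseteq> I\<close> by (intro independent_choice_mono[OF t]) auto
  ultimately have "independent_choice G V (insert k (I - H) \<union> (H - {k})) t'"
    unfolding t'_def using s'_nonadj by (intro independent_choice_override_on) auto
  moreover have "insert k (I - H) \<union> (H - {k}) = insert k I" using \<open>H \<subseteq> I\<close> by blast
  moreover have "conflicts G I t' x \<subseteq> H - {k}"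
    using s'_nonadj by (auto simp: conflicts_def t'_def override_on_def)
  ultimately show ?thesis using k(1) by metis
qed

lemma no_extension_contract:
  assumes "finite I" and "a \<notin> I" and t: "independent_choice G V I t"
    and t_min: "\<And>s. independent_choice G V I s \<Longrightarrow>
      card (conflicts G I t x) \<le> card (conflicts G I s x)"
    and no_extension: "\<nexists>s. independent_choice G V (insert a I) s"
  shows "\<nexists>s. independent_choice G (contracted_classes G V I a t x)
    (insert a (I - conflicts G I t x)) s"
proof
  let ?H = "conflicts G I t x"
  assume "\<exists>s. independent_choice G (contracted_classes G V I a t x) (insert a (I - ?H)) s"
  then obtain k t' where k: "k \<in> insert a ?H" and t': "independent_choice G V (insert k I) t'"
    and fewer: "conflicts G I t' x \<subseteq> ?H - {k}"
    using independent_choice_uncontract[OF t \<open>a \<notin> I\<close>] by blast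
  have "k \<in> ?H" using k t' no_extension by blast
  then have "insert k I = I" using conflicts_subset[of G I t x] by blast
  then have "card ?H \<le> card (conflicts G I t' x)" using t_min t' by simp
  moreover have "conflicts G I t' x \<subset> ?H" using fewer \<open>k \<in> ?H\<close> by blast
  then have "card (conflicts G I t' x) < card ?H"
    using finite_conflicts[OF \<open>finite I\<close>] by (rule psubset_card_mono[rotated])
  ultimately show False by simp
qed

lemma totally_dominating_set_if_no_extension:
  assumes "finite I" and "a \<notin> I" and "\<And>i. i \<in> insert a I \<Longrightarrow> V i \<subseteq> verts G"
    and "independent_choice G V I t" and "\<nexists>t'. independent_choice G V (insert a I) t'"
  shows "\<exists>J\<subseteq>I. \<exists>D. totally_dominating_set G V (insert a J) D \<and> card D \<le> 2 * card J"
  using assms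
proof (induction I arbitrary: V t rule: finite_psubset_induct)
  case (psubset I)
  show ?case
  proof (cases "V a = {}")
    case True
    then have "totally_dominating_set G V (insert a {}) {}"
      by (simp add: totally_dominating_set_def)
    then show ?thesis by (intro exI[of _ "{}"]) auto
  next
    case False
    then obtain x where x: "x \<in> V a" "x \<in> verts G" using psubset.prems(2) by blast
    obtain t where t: "independent_choice G V I t"
      and t_min: "\<And>s. independent_choice G V I s \<Longrightarrow>
        card (conflicts G I t x) \<le> card (conflicts G I s x)"
      using ex_has_least_nat[of "independent_choice G V I" _ "\<lambda>s. card (conflicts G I s x)"]
        psubset.prems(3) by blast
    let ?H = "conflicts G I t x" and ?V' = "contracted_classes G V I a t x"
    have "?H \<noteq> {}"
      using independent_choice_insert[OF t _ x] psubset.prems(4) by blast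
    have "\<exists>J\<subseteq>I - ?H. \<exists>D. totally_dominating_set G ?V' (insert a J) D \<and> card D \<le> 2 * card J"
    proof (rule psubset.IH)
      show "I - ?H \<subset> I" using conflicts_subset[of G I t x] \<open>?H \<noteq> {}\<close> by blast
      show "?V' i \<subseteq> verts G" if "i \<in> insert a (I - ?H)" for i
        using that contracted_classes_subset[of i a I G V t x] psubset.prems(2) by blast
      show "independent_choice G ?V' (I - ?H) t"
        using t \<open>a \<notin> I\<close> by (rule independent_choice_contract)
      show "\<nexists>s. independent_choice G ?V' (insert a (I - ?H)) s"
        using \<open>finite I\<close> \<open>a \<notin> I\<close> t t_min psubset.prems(4) by (rule no_extension_contract)
    qed (use \<open>a \<notin> I\<close> in blast)
    then show ?thesis
      using small_totally_dominating_set_uncontract[OF \<open>finite I\<close> \<open>a \<notin> I\<close> t x(1) \<open>?H \<noteq> {}\<close>]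
      by blast
  qed
qed

theorem haxell_domination:
  assumes "finite I" and "\<And>i. i \<in> I \<Longrightarrow> V i \<subseteq> verts G"
    and "\<And>J D. \<lbrakk>J \<subseteq> I; J \<noteq> {}; totally_dominating_set G V J D\<rbrakk> \<Longrightarrow> 2 * (card J - 1) < card D"
  shows "\<exists>t. independent_choice G V I t"
  using assms
proof (induction I rule: finite_induct)
  case empty
  then show ?case by (simp add: independent_choice_def independent_set_def)
next
  case (insert a I)
  have "\<exists>t. independent_choice G V I t"
    using insert.prems(1) by (intro insert.IH insert.prems(2)) auto
  then obtain t where t: "independent_choice G V I t" ..
  show ?case
  proof (rule ccontr)
    assume "\<not> ?case"
    then obtain J D where J: "J \<subseteq> I" and D: "totally_dominating_set G V (insert a J) D"
      and "card D \<le> 2 * card J"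
      using totally_dominating_set_if_no_extension[OF insert.hyps insert.prems(1) t] by blast
    moreover have "card (insert a J) - 1 = card J"
      using J insert.hyps finite_subset[of J I] by (subst card_insert_disjoint) auto
    ultimately show False
      using insert.prems(2)[OF _ _ D] by fastforce
  qed
qed

theorem haxell_max_degree:
  assumes "finite (verts G)" and "finite I" and V: "\<And>i. i \<in> I \<Longrightarrow> V i \<subseteq> verts G"
    and disjoint: "disjoint_family_on V I" and "0 < d"
    and degree: "\<And>v. v \<in> verts G \<Longrightarrow> num_neighbors G v \<le> d"
    and size: "\<And>i. i \<in> I \<Longrightarrow> 2 * d \<le> card (V i)"
  shows "\<exists>t. independent_choice G V I t"
proof (rule haxell_domination[OF \<open>finite I\<close> V])
  fix J D
  assume J: "J \<subseteq> I" "J \<noteq> {}" and "totally_dominating_set G V J D"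
  then have D: "finite D" "D \<subseteq> (\<Union>j\<in>J. V j)" "(\<Union>j\<in>J. V j) \<subseteq> neighbourhood G D"
    by (simp_all add: totally_dominating_set_def)
  have "finite J" using J \<open>finite I\<close> finite_subset by blast
  have V_J: "V j \<subseteq> verts G" if "j \<in> J" for j using V J that by blast
  have "2 * (card J - 1) * d < card J * (2 * d)"
    using J \<open>finite J\<close> \<open>0 < d\<close> by (simp add: card_gt_0_iff)
  also have "\<dots> \<le> (\<Sum>j\<in>J. card (V j))"
    using sum_bounded_below[of J "2 * d" "\<lambda>j. card (V j)"] size J by auto
  also have "\<dots> = card (\<Union>j\<in>J. V j)"
  proof (rule card_UN_disjoint'[symmetric])
    show "disjoint_family_on V J" using J(1) disjoint by (rule disjoint_family_on_mono)
    show "finite (V j)" if "j \<in> J" for j using V_J[OF that] \<open>finite (verts G)\<close> by (rule finite_subset)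
  qed fact
  also have "\<dots> \<le> card (neighbourhood G D)"
    using D(3) \<open>finite (verts G)\<close> by (intro card_mono) (simp_all add: neighbourhood_def)
  also have "\<dots> \<le> card D * d"
    using D(1,2) V_J degree by (intro card_neighbourhood_le) auto
  finally show "2 * (card J - 1) < card D"
    by simp
qed

theorem disjoint_independent_transversals:
  assumes "finite (verts G)" and "finite I" and V: "\<And>i. i \<in> I \<Longrightarrow> V i \<subseteq> verts G"
    and disjoint: "disjoint_family_on V I" and "0 < d"
    and degree: "\<And>v. v \<in> verts G \<Longrightarrow> num_neighbors G v \<le> d"
    and size: "\<And>i. i \<in> I \<Longrightarrow> 2 * d + n \<le> Suc (card (V i))"
  shows "\<exists>S. disjoint_family_on S {1..n} \<and> (\<forall>k\<in>{1..n}. independent_transversal G V I (S k))"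
  using size
proof (induction n)
  case 0
  then show ?case by (simp add: disjoint_family_on_def)
next
  case (Suc n)
  obtain S where S: "disjoint_family_on S {1..n}"
    and transversal: "\<And>k. k \<in> {1..n} \<Longrightarrow> independent_transversal G V I (S k)"
    using Suc.IH Suc.prems by fastforce
  define W where "W i = V i - (\<Union>k\<in>{1..n}. S k)" for i
  have W_V: "W i \<subseteq> V i" for i by (auto simp: W_def)
  have "\<exists>t. independent_choice G W I t"
  proof (rule haxell_max_degree[OF assms(1,2) _ _ \<open>0 < d\<close> degree])
    show "W i \<subseteq> verts G" if "i \<in> I" for i using V that W_V by blast
    show "disjoint_family_on W I"
      using disjoint by (rule disjoint_family_on_bisimulation) (auto simp: W_def)
    show "2 * d \<le> card (W i)" if "i \<in> I" for i
      using card_Diff_independent_transversals[of "{1..n}" G V I S i] transversal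
        Suc.prems[OF that] that by (simp add: W_def)
  qed
  then obtain t where t: "independent_choice G W I t" ..
  define S' where "S' = S(Suc n := t ` I)"
  have "independent_transversal G V I (t ` I)"
    using independent_choice_mono[OF t] W_V disjoint by (intro independent_transversal_image) auto
  then have "independent_transversal G V I (S' k)" if "k \<in> {1..Suc n}" for k
    using transversal that by (auto simp: S'_def le_Suc_eq)
  moreover have "t ` I \<inter> (\<Union>k\<in>{1..n}. S k) = {}"
    using t by (auto simp: independent_choice_def W_def)
  with S have "disjoint_family_on S' (insert (Suc n) {1..n})"
    by (subst disjoint_family_on_insert) (auto simp: S'_def disjoint_family_on_def)
  then have "disjoint_family_on S' {1..Suc n}"
    by (simp add: atLeastAtMostSuc_conv)
  ultimately show ?case by (intro exI[of _ S']) blast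
qed

end

theorem theorem5p5:
  fixes G :: "('a, 'b) pre_digraph" and V :: "nat \<Rightarrow> 'a set" and m q :: nat
  assumes "graph G"
    and "(\<Union>j\<in>{1..m}. V j) = verts G"
    and "disjoint_family_on V {1..m}"
    and "primepow q"
    and "\<forall>v\<in>verts G. q > 2 * num_neighbors G v + num_at_distance_two G v"
    and "\<forall>j\<in>{1..m}. card (V j) \<ge> 2 * q - 1"
  shows "\<exists>S :: nat \<Rightarrow> 'a set.
           disjoint_family_on S {1..q} \<and>
           (\<forall>i\<in>{1..q}. independent_set G (S i)) \<and>
           (\<forall>i\<in>{1..q}. \<forall>j\<in>{1..m}. S i \<inter> V j \<noteq> {})"
proof -
  interpret graph G by fact
  have "1 < q" using primepow_gt_Suc_0[OF \<open>primepow q\<close>] by simp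
  have "\<exists>S. disjoint_family_on S {1..q} \<and>
          (\<forall>i\<in>{1..q}. independent_transversal G V {1..m} (S i))"
  proof (rule disjoint_independent_transversals)
    show "V j \<subseteq> verts G" if "j \<in> {1..m}" for j using assms(2) that by blast
    show "0 < q div 2" using \<open>1 < q\<close> by simp
    show "num_neighbors G v \<le> q div 2" if "v \<in> verts G" for v using assms(5) that by fastforce
    show "2 * (q div 2) + q \<le> Suc (card (V j))" if "j \<in> {1..m}" for j
      using assms(6) that \<open>1 < q\<close> by fastforce
  qed (use assms(3) in auto)
  then show ?thesis
    unfolding independent_transversal_def by (fastforce elim: is_singletonE)
qed

end
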